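(* (1) If $f\in\mathscr C$ and $g$ is an entire function such that $$0<\liminf_{r\to\infty}\frac{M_g(r)}{M_f(r)}\le\limsup_{r\to\infty}\frac{M_g(r)}{M_f(r)}<\infty,$$ then $g\in\mathscr C$ as well. (2) If $f\in\mathscr C$, $\rho_f=\infty$, and $g$ is an entire function such that $$0<\liminf_{r\to\infty}\frac{m_g(r)}{m_f(r)}\le\limsup_{r\to\infty}\frac{m_g(r)}{m_f(r)}<\infty,$$ then $g\in\mathscr C$ as well. (3) If $f\in\mathscr C$, then $f^n\in\mathscr C$ for all $n\in\mathbb N$ (where $f^n$ is the $n$-th power of $f$).
   Context: Entire functions are functions on some $\mathbb C^n$, $n\ge1$; $\mathbb B^n_r\subset\mathbb C^n$ is the open Euclidean ball of radius $r$ centered at $0$. For an entire function $f$ on $\mathbb C^n$: $M_f(r):=\sup_{\mathbb B^n_r}|f|$, $m_f(r):=\ln M_f(r)$, the order is $\rho_f:=\limsup_{r\to\infty}\frac{\ln m_f(r)}{\ln r}$, and $\phi_f(t):=m_f(e^t)$, $t\in\mathbb R$ (a convex increasing function for nonconstant $f$). Class $\mathscr C$ consists of the nonpolynomial entire functions $f$ satisfying one of the following: (I) $\rho_f<\infty$ and $\limsup_{t\to\infty}\frac{\phi_f(t+1)-\phi_f(t)}{\phi_f(t)-\phi_f(t-1)}<\infty$; (II) $\rho_f=\infty$ and $\lim_{t\to\infty}t^2\left(\frac1{\ln\psi(t)}\right)'=0$ (limit over the points where $\psi'$ exists) for some convex increasing $\psi\in C(\mathbb R)$ with $\lim_{t\to\infty}\frac{\ln\psi(t)}{\ln\phi_f(t)}=1$.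 *)

theory Defs
  imports "HOL-Analysis.Analysis"
begin

text \<open>The norm of \<^typ>\<open>complex ^ 'n\<close> is the Euclidean one, so \<^term>\<open>ball 0 r\<close> is the
  Euclidean ball. A function is entire if it is complex differentiable everywhere,
  i.e. its real Frechet derivative exists and is complex linear.\<close>

definition entire :: "(complex ^ 'n \<Rightarrow> complex) \<Rightarrow> bool" where
  "entire f \<longleftrightarrow>
     (\<forall>z. \<exists>L. (f has_derivative L) (at z) \<and> (\<forall>c v. L (c *s v) = c * L v))"

definition polynomial_fun :: "(complex ^ 'n \<Rightarrow> complex) \<Rightarrow> bool" where
  "polynomial_fun f \<longleftrightarrow>
     (\<exists>(A :: ('n \<Rightarrow> nat) set) c. finite A \<and>
        (\<forall>z. f z = (\<Sum>\<alpha>\<in>A. c \<alpha> * (\<Prod>i\<in>UNIV. (z $ i) ^ \<alpha> i))))"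

text \<open>The following are meaningful for entire \<open>f \<noteq> 0\<close> and \<open>r > 0\<close> (respectively for
  nonconstant \<open>f\<close> and all large \<open>r\<close>, where an iterated logarithm occurs); only such values
  matter below, since all limits are taken at infinity.\<close>

definition max_mod :: "(complex ^ 'n \<Rightarrow> complex) \<Rightarrow> real \<Rightarrow> real" where
  "max_mod f r = (SUP z\<in>ball 0 r. cmod (f z))"

definition log_max_mod :: "(complex ^ 'n \<Rightarrow> complex) \<Rightarrow> real \<Rightarrow> real" where
  "log_max_mod f r = ln (max_mod f r)"

definition growth_order :: "(complex ^ 'n \<Rightarrow> complex) \<Rightarrow> ereal" where
  "growth_order f = Limsup at_top (\<lambda>r. ereal (ln (log_max_mod f r) / ln r))"

definition phi :: "(complex ^ 'n \<Rightarrow> complex) \<Rightarrow> real \<Rightarrow> real" where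
  "phi f t = log_max_mod f (exp t)"

definition type_I :: "(complex ^ 'n \<Rightarrow> complex) \<Rightarrow> bool" where
  "type_I f \<longleftrightarrow> growth_order f < \<infinity> \<and>
     Limsup at_top (\<lambda>t. ereal ((phi f (t + 1) - phi f t) / (phi f t - phi f (t - 1)))) < \<infinity>"

text \<open>The last limit is restricted to the points where \<open>\<psi>\<close> is differentiable. The
  asymptotic relation forces \<open>\<psi>\<close> to tend to infinity, so that \<open>1 / ln \<psi>\<close> is differentiable
  at all sufficiently large such points.\<close>

definition type_II :: "(complex ^ 'n \<Rightarrow> complex) \<Rightarrow> bool" where
  "type_II f \<longleftrightarrow> growth_order f = \<infinity> \<and>
     (\<exists>\<psi> :: real \<Rightarrow> real.
        convex_on UNIV \<psi> \<and> mono \<psi> \<and> continuous_on UNIV \<psi> \<and>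
        ((\<lambda>t. ln (\<psi> t) / ln (phi f t)) \<longlongrightarrow> 1) at_top \<and>
        ((\<lambda>t. t\<^sup>2 * deriv (\<lambda>s. 1 / ln (\<psi> s)) t) \<longlongrightarrow> 0)
          (inf at_top (principal {t. \<psi> differentiable (at t)})))"

definition class_C :: "(complex ^ 'n \<Rightarrow> complex) \<Rightarrow> bool" where
  "class_C f \<longleftrightarrow> entire f \<and> \<not> polynomial_fun f \<and> (type_I f \<or> type_II f)"

end

theory Submission
  imports Defs "HOL-Complex_Analysis.Conformal_Mappings" "HOL-Real_Asymp.Real_Asymp"
begin

section \<open>Polynomials in several variables\<close>

text \<open>Membership in the class survives small changes of the maximum modulus near infinity. A
  two-sided bound on \<open>M_g / M_f\<close> makes \<open>m_g - m_f\<close> bounded, and a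
  two-sided bound on \<open>m_g / m_f\<close> makes \<open>ln m_g - ln m_f\<close> bounded. As
  \<open>m_f\<close> tends to infinity for nonpolynomial \<open>f\<close>, the first situation
  implies the second.

  A bounded error in \<open>ln m_f\<close> stays bounded after division by \<open>ln r\<close>, so
  finiteness of the order is preserved (\<open>growth_order_finite_iff\<close>). It also disappears
  in the quotient of \<open>ln phi_f\<close> by \<open>ln phi_g\<close>, so the function
  \<open>\<psi>\<close> that witnesses type II for \<open>f\<close> witnesses it for
  \<open>g\<close> (\<open>type_II_transfer\<close>).

  Type I concerns increments of \<open>phi\<close>. A bounded error in \<open>m_f\<close> does no
  harm there because these increments tend to infinity (\<open>phi_increment_at_top\<close>): the
  maximum principle for \<open>f (t u) / t^p\<close> on annuli in complex lines, combined with
  Liouville's theorem, shows that \<open>M_f(r) / r^p\<close> is eventually increasing for every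
  \<open>p\<close>, hence \<open>M_f(e r) \<ge> e^p M_f(r)\<close> for large \<open>r\<close>.

  Finally, \<open>g\<close> is not a polynomial: otherwise \<open>m_f = O(ln r)\<close>, and
  Liouville's theorem on coordinate lines together with interpolation would make \<open>f\<close> a
  polynomial (\<open>polynomial_fun_if_max_mod_le\<close>). For powers,
  \<open>m_{f^k} = k m_f\<close>; the factor \<open>k\<close> cancels in the quotient of type I, and
  type II is covered by comparability of \<open>m\<close>.\<close>

lemma polynomial_fun_0: "polynomial_fun (\<lambda>z. 0)"
  unfolding polynomial_fun_def by (intro exI[of _ "{}"]) simp

lemma polynomial_fun_const: "polynomial_fun (\<lambda>z. a)"
  unfolding polynomial_fun_def by (intro exI[of _ "{\<lambda>_. 0}"] exI[of _ "\<lambda>_. a"]) simp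

lemma polynomial_fun_add:
  assumes "polynomial_fun f" "polynomial_fun g"
  shows "polynomial_fun (\<lambda>z. f z + g z)"
proof -
  obtain A c where A: "finite A" "\<And>z. f z = (\<Sum>\<alpha>\<in>A. c \<alpha> * (\<Prod>i\<in>UNIV. (z $ i) ^ \<alpha> i))"
    using assms(1) unfolding polynomial_fun_def by blast
  obtain B d where B: "finite B" "\<And>z. g z = (\<Sum>\<alpha>\<in>B. d \<alpha> * (\<Prod>i\<in>UNIV. (z $ i) ^ \<alpha> i))"
    using assms(2) unfolding polynomial_fun_def by blast
  define c' where "c' \<alpha> = (if \<alpha> \<in> A then c \<alpha> else 0)" for \<alpha>
  define d' where "d' \<alpha> = (if \<alpha> \<in> B then d \<alpha> else 0)" for \<alpha>
  have "f z = (\<Sum>\<alpha>\<in>A \<union> B. c' \<alpha> * (\<Prod>i\<in>UNIV. (z $ i) ^ \<alpha> i))" for z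
    unfolding A(2) using A(1) B(1)
    by (intro sum.mono_neutral_cong_left) (auto simp: c'_def)
  moreover have "g z = (\<Sum>\<alpha>\<in>A \<union> B. d' \<alpha> * (\<Prod>i\<in>UNIV. (z $ i) ^ \<alpha> i))" for z
    unfolding B(2) using A(1) B(1)
    by (intro sum.mono_neutral_cong_left) (auto simp: d'_def)
  ultimately show ?thesis
    unfolding polynomial_fun_def using A(1) B(1)
    by (intro exI[of _ "A \<union> B"] exI[of _ "\<lambda>\<alpha>. c' \<alpha> + d' \<alpha>"])
       (simp add: distrib_right sum.distrib)
qed

lemma polynomial_fun_cmult:
  assumes "polynomial_fun f"
  shows "polynomial_fun (\<lambda>z. a * f z)"
proof -
  obtain A c where A: "finite A" "\<And>z. f z = (\<Sum>\<alpha>\<in>A. c \<alpha> * (\<Prod>i\<in>UNIV. (z $ i) ^ \<alpha> i))"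
    using assms unfolding polynomial_fun_def by blast
  then show ?thesis
    unfolding polynomial_fun_def
    by (intro exI[of _ A] exI[of _ "\<lambda>\<alpha>. a * c \<alpha>"]) (simp add: sum_distrib_left mult.assoc)
qed

lemma polynomial_fun_coord_mult:
  assumes "polynomial_fun f"
  shows "polynomial_fun (\<lambda>z. z $ i * f z)"
proof -
  obtain A c where A: "finite A" "\<And>z. f z = (\<Sum>\<alpha>\<in>A. c \<alpha> * (\<Prod>i\<in>UNIV. (z $ i) ^ \<alpha> i))"
    using assms unfolding polynomial_fun_def by blast
  \<comment> \<open>Multiplication by \<open>z $ i\<close> shifts exponents by \<open>s\<close>;
    injectivity lets \<open>inv s\<close> recover the old coefficient.\<close>
  define s where "s \<alpha> = \<alpha>(i := Suc (\<alpha> i))" for \<alpha> :: "'a \<Rightarrow> nat"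
  have inj: "inj s"
    unfolding s_def inj_def fun_eq_iff by (metis fun_upd_apply nat.inject)
  have prod: "(\<Prod>j\<in>UNIV. (z $ j) ^ s \<alpha> j) = z $ i * (\<Prod>j\<in>UNIV. (z $ j) ^ \<alpha> j)"
    for z :: "complex ^ 'a" and \<alpha>
  proof -
    have "(\<Prod>j\<in>UNIV. (z $ j) ^ s \<alpha> j) = (z $ i) ^ s \<alpha> i * (\<Prod>j\<in>UNIV - {i}. (z $ j) ^ s \<alpha> j)"
      by (rule prod.remove) auto
    also have "(\<Prod>j\<in>UNIV - {i}. (z $ j) ^ s \<alpha> j) = (\<Prod>j\<in>UNIV - {i}. (z $ j) ^ \<alpha> j)"
      by (rule prod.cong) (auto simp: s_def)
    also have "(z $ i) ^ s \<alpha> i * \<dots> = z $ i * ((z $ i) ^ \<alpha> i * \<dots>)"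
      by (simp add: s_def)
    also have "(z $ i) ^ \<alpha> i * (\<Prod>j\<in>UNIV - {i}. (z $ j) ^ \<alpha> j) = (\<Prod>j\<in>UNIV. (z $ j) ^ \<alpha> j)"
      by (rule prod.remove[symmetric]) auto
    finally show ?thesis .
  qed
  have "z $ i * f z = (\<Sum>\<beta>\<in>s ` A. c (inv s \<beta>) * (\<Prod>i\<in>UNIV. (z $ i) ^ \<beta> i))" for z
  proof -
    have "(\<Sum>\<beta>\<in>s ` A. c (inv s \<beta>) * (\<Prod>i\<in>UNIV. (z $ i) ^ \<beta> i))
        = (\<Sum>\<alpha>\<in>A. c \<alpha> * (z $ i * (\<Prod>j\<in>UNIV. (z $ j) ^ \<alpha> j)))"
      by (subst sum.reindex[OF inj_on_subset[OF inj subset_UNIV]]) (simp add: inj prod)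
    then show ?thesis
      by (simp add: A(2) sum_distrib_left mult.left_commute)
  qed
  then show ?thesis
    unfolding polynomial_fun_def using A(1)
    by (intro exI[of _ "s ` A"] exI[of _ "\<lambda>\<beta>. c (inv s \<beta>)"]) simp
qed

lemma polynomial_fun_poly_coord_mult:
  assumes "polynomial_fun f"
  shows "polynomial_fun (\<lambda>z. poly p (z $ i) * f z)"
proof (induction p)
  case 0
  show ?case by (simp add: polynomial_fun_0)
next
  case (pCons a p)
  have "polynomial_fun (\<lambda>z. a * f z + z $ i * (poly p (z $ i) * f z))"
    by (intro polynomial_fun_add polynomial_fun_cmult polynomial_fun_coord_mult assms pCons)
  then show ?case by (simp add: algebra_simps)
qed

lemma polynomial_fun_sum:
  assumes "\<And>x. x \<in> X \<Longrightarrow> polynomial_fun (f x)"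
  shows "polynomial_fun (\<lambda>z. \<Sum>x\<in>X. f x z)"
  using assms
  by (induction X rule: infinite_finite_induct) (auto intro: polynomial_fun_add polynomial_fun_0)

section \<open>Recognising polynomials by interpolation\<close>

text \<open>The \<open>L j\<close> are the Lagrange basis for the nodes 0, ..., \<open>N\<close>;
  both sides have degree at most \<open>N\<close> and agree at \<open>N + 1\<close> points. The
  basis depends on \<open>N\<close> only, so one choice serves the restrictions to all parallel
  lines.\<close>

lemma lagrange_interpolation:
  obtains L :: "nat \<Rightarrow> complex poly"
  where "\<And>p x. degree p \<le> N \<Longrightarrow> poly p x = (\<Sum>j\<le>N. poly p (of_nat j) * poly (L j) x)"
proof -
  define L :: "nat \<Rightarrow> complex poly"
    where "L j = (\<Prod>m\<in>{..N} - {j}. smult (1 / (of_nat j - of_nat m)) [:- of_nat m, 1:])" for j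
  have L: "poly (L j) (of_nat k) = (if j = k then 1 else 0)" if "k \<le> N" for j k
  proof (cases "j = k")
    case True
    then show ?thesis
      by (auto simp: L_def poly_prod diff_divide_distrib[symmetric] intro!: prod.neutral)
  next
    case False
    then show ?thesis
      using that by (auto simp: L_def poly_prod)
  qed
  have deg_L: "degree (L j) \<le> N" if "j \<le> N" for j
  proof -
    have "degree (L j) \<le> (\<Sum>m\<in>{..N} - {j}. degree (smult (1 / (of_nat j - of_nat m)) [:- of_nat m, 1::complex:]))"
      unfolding L_def by (rule degree_prod_sum_le[unfolded o_def]) auto
    also have "\<dots> \<le> (\<Sum>m\<in>{..N} - {j}. 1)"
      by (intro sum_mono) (auto intro: order.trans[OF degree_smult_le])
    also have "\<dots> = N" using that by simp
    finally show ?thesis .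
  qed
  have "p = (\<Sum>j\<le>N. smult (poly p (of_nat j)) (L j))" if "degree p \<le> N" for p
  proof (rule poly_eqI_degree[where A = "of_nat ` {..N}"])
    show "poly p x = poly (\<Sum>j\<le>N. smult (poly p (of_nat j)) (L j)) x"
      if "x \<in> of_nat ` {..N}" for x
      using that by (auto simp: poly_sum L sum.delta if_distrib cong: if_cong)
    have "card (of_nat ` {..N} :: complex set) = Suc N"
      by (subst card_image) (auto simp: inj_on_def)
    moreover have "degree (\<Sum>j\<le>N. smult (poly p (of_nat j)) (L j)) \<le> N"
      by (intro degree_sum_le) (auto intro: order.trans[OF degree_smult_le] deg_L)
    ultimately show "degree p < card (of_nat ` {..N} :: complex set)"
      "degree (\<Sum>j\<le>N. smult (poly p (of_nat j)) (L j)) < card (of_nat ` {..N} :: complex set)"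
      using that by auto
  qed
  then have "poly p x = (\<Sum>j\<le>N. poly p (of_nat j) * poly (L j) x)" if "degree p \<le> N" for p x
    using that by (metis (no_types, lifting) poly_smult poly_sum sum.cong)
  then show thesis by (rule that)
qed

definition vec_upd :: "'a ^ 'n \<Rightarrow> 'n \<Rightarrow> 'a \<Rightarrow> 'a ^ 'n" where
  "vec_upd z i t = (\<chi> j. if j = i then t else z $ j)"

lemma vec_upd_simps [simp]:
  "vec_upd z i t $ j = (if j = i then t else z $ j)"
  "vec_upd (vec_upd z i s) i t = vec_upd z i t"
  "vec_upd z i (z $ i) = z"
  by (auto simp: vec_upd_def vec_eq_iff)

lemma vec_upd_commute: "i \<noteq> j \<Longrightarrow> vec_upd (vec_upd z i s) j t = vec_upd (vec_upd z j t) i s"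
  by (auto simp: vec_eq_iff)

text \<open>The variables are removed one at a time: Lagrange interpolation in \<open>z $ i\<close> expresses \<open>f\<close>
  through its restrictions to the hyperplanes \<open>z $ i = j\<close>, \<open>j \<le> N\<close>. The common degree bound \<open>N\<close> makes
  this possible without knowing how the coefficients depend on the other variables.\<close>
lemma polynomial_fun_if_separately_polynomial:
  fixes f :: "complex ^ 'n \<Rightarrow> complex"
  assumes "\<And>a i. \<exists>p. degree p \<le> N \<and> (\<forall>t. f (vec_upd a i t) = poly p t)"
  shows "polynomial_fun f"
proof -
  obtain L :: "nat \<Rightarrow> complex poly"
    where L: "\<And>p x. degree p \<le> N \<Longrightarrow> poly p x = (\<Sum>j\<le>N. poly p (of_nat j) * poly (L j) x)"
    using lagrange_interpolation by blast
  \<comment> \<open>Induction over a finite set \<open>S\<close> of variables that determine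
    \<open>f\<close>. The function is kept general because the induction hypothesis is applied to
    restrictions of \<open>f\<close> to hyperplanes.\<close>
  have main: "polynomial_fun f"
    if "finite S" "\<And>a i. \<exists>p. degree p \<le> N \<and> (\<forall>t. f (vec_upd a i t) = poly p t)"
      and "\<And>z w. (\<And>i. i \<in> S \<Longrightarrow> z $ i = w $ i) \<Longrightarrow> f z = f w"
    for S and f :: "complex ^ 'n \<Rightarrow> complex"
    using that
  proof (induction S arbitrary: f)
    case empty
    then have "f = (\<lambda>z. f 0)" by auto
    then show ?case using polynomial_fun_const by metis
  next
    case (insert i S)
    have "polynomial_fun (\<lambda>z. f (vec_upd z i (of_nat j)))" for j
    proof (rule insert.IH)
      fix a k
      show "\<exists>p. degree p \<le> N \<and> (\<forall>t. f (vec_upd (vec_upd a k t) i (of_nat j)) = poly p t)"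
      proof (cases "k = i")
        case True
        then show ?thesis by (intro exI[of _ "[:f (vec_upd a i (of_nat j)):]"]) simp
      next
        case False
        then show ?thesis
          using insert.prems(1)[of "vec_upd a i (of_nat j)" k] vec_upd_commute by metis
      qed
    qed (auto intro: insert.prems(2))
    then have "polynomial_fun (\<lambda>z. \<Sum>j\<le>N. poly (L j) (z $ i) * f (vec_upd z i (of_nat j)))"
      by (intro polynomial_fun_sum polynomial_fun_poly_coord_mult)
    also have "(\<lambda>z. \<Sum>j\<le>N. poly (L j) (z $ i) * f (vec_upd z i (of_nat j))) = f"
    proof
      fix z
      obtain p where p: "degree p \<le> N" "\<And>t. f (vec_upd z i t) = poly p t"
        using insert.prems(1) by blast
      have "f z = poly p (z $ i)" using p(2)[of "z $ i"] by simp
      then show "(\<Sum>j\<le>N. poly (L j) (z $ i) * f (vec_upd z i (of_nat j))) = f z"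
        using L[OF p(1), of "z $ i"] by (simp only: p(2) mult.commute)
    qed
    finally show ?case .
  qed
  show ?thesis
  proof (rule main[of UNIV])
    show "f z = f w" if "\<And>i. i \<in> UNIV \<Longrightarrow> z $ i = w $ i" for z w
      using that vec_eq_iff[of z w] by simp
  qed (use assms in auto)
qed

lemma polynomial_fun_growth:
  fixes f :: "complex ^ 'n \<Rightarrow> complex"
  assumes "polynomial_fun f"
  obtains C N where "C \<ge> 0" "\<And>z. cmod (f z) \<le> C * (1 + norm z) ^ N"
proof -
  obtain A c where A: "finite A" "\<And>z. f z = (\<Sum>\<alpha>\<in>A. c \<alpha> * (\<Prod>i\<in>UNIV. (z $ i) ^ \<alpha> i))"
    using assms unfolding polynomial_fun_def by blast
  \<comment> \<open>A crude degree bound: each total degree is at most the sum of all of them. The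
    base \<open>1 + norm z\<close> is at least 1, so raising the exponent is harmless.\<close>
  define N where "N = (\<Sum>\<alpha>\<in>A. \<Sum>i\<in>UNIV. \<alpha> i)"
  have "cmod (f z) \<le> (\<Sum>\<alpha>\<in>A. cmod (c \<alpha>)) * (1 + norm z) ^ N" for z
  proof -
    have "cmod (\<Prod>i\<in>UNIV. (z $ i) ^ \<alpha> i) \<le> (1 + norm z) ^ N" if "\<alpha> \<in> A" for \<alpha>
    proof -
      have "cmod (\<Prod>i\<in>UNIV. (z $ i) ^ \<alpha> i) = (\<Prod>i\<in>UNIV. cmod (z $ i) ^ \<alpha> i)"
        by (simp add: prod_norm[symmetric] norm_power)
      also have "\<dots> \<le> (\<Prod>i\<in>UNIV. (1 + norm z) ^ \<alpha> i)"
        by (intro prod_mono conjI power_mono add_increasing Finite_Cartesian_Product.norm_nth_le) auto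
      also have "\<dots> = (1 + norm z) ^ (\<Sum>i\<in>UNIV. \<alpha> i)"
        by (simp add: power_sum)
      also have "\<dots> \<le> (1 + norm z) ^ N"
        using A(1) that unfolding N_def
        by (intro power_increasing member_le_sum[where f = "\<lambda>\<alpha>. \<Sum>i\<in>UNIV. \<alpha> i"]) auto
      finally show ?thesis .
    qed
    then have "cmod (f z) \<le> (\<Sum>\<alpha>\<in>A. cmod (c \<alpha>) * (1 + norm z) ^ N)"
      unfolding A(2)
      by (intro order.trans[OF norm_sum] sum_mono) (auto simp: norm_mult intro: mult_left_mono)
    then show ?thesis by (simp add: sum_distrib_right)
  qed
  then show thesis by (intro that[of "\<Sum>\<alpha>\<in>A. cmod (c \<alpha>)" N]) (auto intro: sum_nonneg)
qed

section \<open>The maximum modulus\<close>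

lemma entire_continuous_on: "entire f \<Longrightarrow> continuous_on S f"
  unfolding entire_def
  by (meson continuous_at_imp_continuous_on has_derivative_continuous)

text \<open>Complex linearity of the derivative \<open>L\<close> makes the chain rule along a
  complex line yield multiplication by \<open>L v\<close>, a complex derivative. Liouville's theorem
  and the maximum principle are applied to such slices.\<close>

lemma entire_holomorphic_slice:
  assumes "entire f"
  shows "(\<lambda>t. f (a + t *s v)) holomorphic_on S"
proof -
  have "(\<lambda>t. f (a + t *s v)) field_differentiable at t" for t
  proof -
    obtain L where L: "(f has_derivative L) (at (a + t *s v))" "\<And>c v. L (c *s v) = c * L v"
      using assms unfolding entire_def by blast
    have "linear (\<lambda>t::complex. t *s v)"
      by (rule linearI) (simp_all add: vec_eq_iff algebra_simps)
    then have "((\<lambda>t. t *s v) has_derivative (\<lambda>t. t *s v)) (at t)"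
      by (intro bounded_linear_imp_has_derivative linear_conv_bounded_linear[THEN iffD1])
    then have "((\<lambda>t. a + t *s v) has_derivative (\<lambda>t. t *s v)) (at t)"
      by (auto intro!: derivative_eq_intros)
    from diff_chain_at[OF this L(1)]
    have "((\<lambda>t. f (a + t *s v)) has_derivative (\<lambda>t. L v * t)) (at t)"
      by (simp add: o_def L(2) mult.commute)
    then show ?thesis
      unfolding field_differentiable_def has_field_derivative_def by blast
  qed
  then show ?thesis
    by (simp add: holomorphic_on_def field_differentiable_at_within)
qed

lemma norm_vector_scalar_mult: "norm (c *s (v :: complex ^ 'n)) = cmod c * norm v"
  by (simp add: norm_vec_def norm_mult L2_set_right_distrib)

lemma bdd_above_entire_ball:
  assumes "entire f"
  shows "bdd_above ((\<lambda>z. cmod (f z)) ` ball 0 r)"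
proof -
  have "compact ((\<lambda>z. cmod (f z)) ` cball 0 r)"
    by (intro compact_continuous_image continuous_intros entire_continuous_on assms) auto
  then have "bdd_above ((\<lambda>z. cmod (f z)) ` cball 0 r)"
    by (intro bounded_imp_bdd_above compact_imp_bounded)
  then show ?thesis
    by (rule bdd_above_mono) auto
qed

text \<open>The supremum is over the open ball; continuity extends the bound to its closure, which
  gives access to points on the sphere.\<close>

lemma max_mod_upper:
  assumes "entire f" "norm z \<le> r" "r > 0"
  shows "cmod (f z) \<le> max_mod f r"
proof -
  have "closure (ball 0 r) \<subseteq> {z. cmod (f z) \<le> max_mod f r}"
  proof (rule closure_minimal)
    show "ball 0 r \<subseteq> {z. cmod (f z) \<le> max_mod f r}"
      unfolding max_mod_def using bdd_above_entire_ball[OF assms(1)] by (auto intro: cSUP_upper)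
    show "closed {z. cmod (f z) \<le> max_mod f r}"
      by (intro closed_Collect_le continuous_intros entire_continuous_on assms)
  qed
  then show ?thesis
    using assms by auto
qed

lemma max_mod_least:
  assumes "r > 0" "\<And>z. norm z < r \<Longrightarrow> cmod (f z) \<le> C"
  shows "max_mod f r \<le> C"
  unfolding max_mod_def using assms by (intro cSUP_least) auto

lemma max_mod_nonneg: "entire f \<Longrightarrow> r > 0 \<Longrightarrow> max_mod f r \<ge> 0"
  using order.trans[OF norm_ge_zero max_mod_upper[of f 0 r]] by simp

lemma max_mod_mono: "entire f \<Longrightarrow> 0 < r \<Longrightarrow> r \<le> s \<Longrightarrow> max_mod f r \<le> max_mod f s"
  by (intro max_mod_least max_mod_upper) auto

lemma entire_power:
  assumes "entire f"
  shows "entire (\<lambda>z. f z ^ k)"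
  unfolding entire_def
proof
  fix z
  obtain L where L: "(f has_derivative L) (at z)" "\<And>c v. L (c *s v) = c * L v"
    using assms unfolding entire_def by blast
  have "((\<lambda>z. f z ^ k) has_derivative (\<lambda>v. of_nat k * L v * f z ^ (k - 1))) (at z)"
    using L(1) by (rule has_derivative_power)
  then show "\<exists>L. ((\<lambda>z. f z ^ k) has_derivative L) (at z) \<and> (\<forall>c v. L (c *s v) = c * L v)"
    using L(2) by (intro exI[of _ "\<lambda>v. of_nat k * L v * f z ^ (k - 1)"]) simp
qed

lemma max_mod_power:
  assumes "entire f" "r > 0" "k \<ge> 1"
  shows "max_mod (\<lambda>z. f z ^ k) r = max_mod f r ^ k"
proof (rule antisym)
  show "max_mod (\<lambda>z. f z ^ k) r \<le> max_mod f r ^ k"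
    using assms by (intro max_mod_least) (auto simp: norm_power intro!: power_mono max_mod_upper)
  \<comment> \<open>A supremum is bounded pointwise, so the reverse inequality is first proved for
    the k-th roots.\<close>
  have "max_mod f r \<le> root k (max_mod (\<lambda>z. f z ^ k) r)"
  proof (rule max_mod_least)
    fix z :: "complex ^ 'a" assume "norm z < r"
    then have "cmod (f z ^ k) \<le> max_mod (\<lambda>z. f z ^ k) r"
      using assms entire_power by (intro max_mod_upper) auto
    then have "root k (cmod (f z) ^ k) \<le> root k (max_mod (\<lambda>z. f z ^ k) r)"
      using assms by (simp add: norm_power)
    then show "cmod (f z) \<le> root k (max_mod (\<lambda>z. f z ^ k) r)"
      using assms by (simp add: real_root_power_cancel)
  qed fact
  then have "max_mod f r ^ k \<le> root k (max_mod (\<lambda>z. f z ^ k) r) ^ k"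
    using assms by (intro power_mono max_mod_nonneg)
  also have "\<dots> = max_mod (\<lambda>z. f z ^ k) r"
    using assms entire_power by (intro real_root_pow_pos2 max_mod_nonneg) auto
  finally show "max_mod f r ^ k \<le> max_mod (\<lambda>z. f z ^ k) r" .
qed

section \<open>Polynomial growth characterises polynomials\<close>

lemma polynomial_fun_max_mod_le:
  assumes "polynomial_fun f"
  obtains C N where "\<And>r. r \<ge> 1 \<Longrightarrow> max_mod f r \<le> C * r ^ N"
proof -
  obtain C N where C: "C \<ge> 0" "\<And>z. cmod (f z) \<le> C * (1 + norm z) ^ N"
    using polynomial_fun_growth[OF assms] by blast
  \<comment> \<open>For \<open>r \<ge> 1\<close> one has \<open>1 + norm z \<le> 2 * r\<close>,
    whence the factor \<open>2 ^ N\<close>.\<close>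
  have "max_mod f r \<le> (C * 2 ^ N) * r ^ N" if "r \<ge> 1" for r
  proof (rule max_mod_least)
    fix z :: "complex ^ 'a" assume "norm z < r"
    then have "C * (1 + norm z) ^ N \<le> C * (2 * r) ^ N"
      using that C(1) by (intro mult_left_mono power_mono) auto
    then show "cmod (f z) \<le> (C * 2 ^ N) * r ^ N"
      using C(2)[of z] by (simp add: power_mult_distrib mult.assoc)
  qed (use that in auto)
  then show thesis by (rule that)
qed

text \<open>Liouville's theorem on each line parallel to a coordinate axis gives a polynomial of
  degree at most \<open>N\<close>. The bound is the same for all lines, as the interpolation
  argument requires.\<close>

lemma polynomial_fun_if_max_mod_le:
  fixes f :: "complex ^ 'n \<Rightarrow> complex"
  assumes "entire f" "eventually (\<lambda>r. max_mod f r \<le> C * r ^ N) at_top"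
  shows "polynomial_fun f"
proof (rule polynomial_fun_if_separately_polynomial)
  fix a :: "complex ^ 'n" and i
  obtain R where R: "\<And>r. r \<ge> R \<Longrightarrow> max_mod f r \<le> C * r ^ N"
    using assms(2) unfolding eventually_at_top_linorder by blast
  define h where "h t = f (vec_upd a i t)" for t
  define b where "b = vec_upd a i 0"
  have h: "h t = f (b + t *s axis i 1)" for t
    unfolding h_def b_def by (rule arg_cong[where f = f]) (simp add: vec_eq_iff axis_def)
  \<comment> \<open>Beyond \<open>A\<close>, the point of the line with parameter \<open>t\<close>
    has norm at most \<open>2 * cmod t\<close>, and this radius is positive and at least
    \<open>R\<close>.\<close>
  define A where "A = max (max R 1) (norm b)"
  have bound: "cmod (h t) \<le> \<bar>C\<bar> * 2 ^ N * cmod t ^ N" if t: "A \<le> cmod t" for t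
  proof -
    have "norm (b + t *s axis i 1) \<le> norm b + cmod t"
      by (rule order.trans[OF norm_triangle_ineq]) (simp add: norm_vector_scalar_mult norm_axis_1)
    then have "cmod (h t) \<le> max_mod f (2 * cmod t)"
      unfolding h using t by (intro max_mod_upper assms) (auto simp: A_def)
    also have "\<dots> \<le> C * (2 * cmod t) ^ N" using t by (intro R) (auto simp: A_def)
    also have "\<dots> \<le> \<bar>C\<bar> * (2 * cmod t) ^ N" by (intro mult_right_mono) auto
    finally show ?thesis by (simp add: power_mult_distrib mult.assoc)
  qed
  have "h holomorphic_on UNIV"
    unfolding h[abs_def] by (rule entire_holomorphic_slice[OF assms(1)])
  from Liouville_polynomial[OF this bound]
  have "h t = poly (\<Sum>k\<le>N. monom ((deriv ^^ k) h 0 / fact k) k) t" for t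
    by (simp add: poly_sum poly_monom)
  moreover have "degree (\<Sum>k\<le>N. monom ((deriv ^^ k) h 0 / fact k) k) \<le> N"
    by (intro degree_sum_le) (auto intro: order.trans[OF degree_monom_le])
  ultimately show "\<exists>p. degree p \<le> N \<and> (\<forall>t. f (vec_upd a i t) = poly p t)"
    unfolding h_def by blast
qed

section \<open>Growth of nonpolynomial entire functions\<close>

text \<open>A form of Hadamard's three circles theorem: the maximum principle for
  \<open>f (t u) / t^p\<close> on an annulus in the complex line through \<open>z\<close>. A natural
  exponent keeps \<open>t^p\<close> single-valued.\<close>

lemma max_mod_three_circles:
  fixes f :: "complex ^ 'n \<Rightarrow> complex"
  assumes f: "entire f" and r: "0 < r1" "r1 \<le> r" "r \<le> r2"
  shows "max_mod f r / r ^ p \<le> max (max_mod f r1 / r1 ^ p) (max_mod f r2 / r2 ^ p)" (is "_ \<le> ?B")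
proof -
  have "cmod (f z) \<le> ?B * r ^ p" if z: "norm z < r" for z
  proof (cases "norm z \<le> r1")
    \<comment> \<open>The quotient \<open>h\<close> used below may have a pole at 0; points in the
      small ball are bounded by \<open>max_mod f r1\<close> directly.\<close>
    case True
    then have "cmod (f z) \<le> max_mod f r1 / r1 ^ p * r1 ^ p"
      using r by (simp add: max_mod_upper f)
    also have "\<dots> \<le> ?B * r ^ p"
      using r by (intro mult_mono power_mono max_mod_nonneg f divide_nonneg_nonneg le_max_iff_disj[THEN iffD2])
        (auto simp: max_mod_nonneg f)
    finally show ?thesis .
  next
    case False
    define u where "u = (1 / of_real (norm z)) *s z"
    have u: "norm u = 1" "of_real (norm z) *s u = z"
      using False r by (auto simp: u_def norm_vector_scalar_mult norm_divide)
    define h where "h t = f (t *s u) / t ^ p" for t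
    define S where "S = cball 0 r2 - ball (0::complex) r1"
    have S: "closed S" "0 \<notin> S" using r by (auto simp: S_def closed_Diff)
    have hol: "h holomorphic_on S"
      unfolding h_def using entire_holomorphic_slice[OF f, of 0 u] S
      by (intro holomorphic_intros) auto
    have "cmod (h (of_real (norm z))) \<le> ?B"
    proof (rule maximum_modulus_frontier[where S = S and f = h])
      show "h holomorphic_on interior S"
        using hol interior_subset holomorphic_on_subset by blast
      show "continuous_on (closure S) h"
        using hol S by (simp add: holomorphic_on_imp_continuous_on)
      show "bounded S" by (auto simp: S_def intro: bounded_subset[OF bounded_cball])
      show "complex_of_real (norm z) \<in> S"
        using False z r by (auto simp: S_def)
      fix w assume "w \<in> frontier S"
      have "interior S = ball 0 r2 - cball 0 r1"
        using r by (simp add: S_def interior_diff)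
      then have "cmod w = r1 \<or> cmod w = r2"
        using \<open>w \<in> frontier S\<close> S r by (auto simp: frontier_def S_def)
      moreover have "cmod (h w) \<le> max_mod f (cmod w) / cmod w ^ p" if "w \<noteq> 0"
        unfolding h_def norm_divide norm_power using that u f
        by (intro divide_right_mono max_mod_upper) (auto simp: norm_vector_scalar_mult)
      ultimately show "cmod (h w) \<le> ?B"
        using r by fastforce
    qed
    then have "cmod (f z) \<le> ?B * norm z ^ p"
      using False r u zero_less_power[of "norm z" p]
      by (simp add: h_def norm_divide norm_power pos_divide_le_eq del: zero_less_norm_iff)
    also have "\<dots> \<le> ?B * r ^ p"
      using z r by (intro mult_left_mono power_mono) (auto simp: le_max_iff_disj max_mod_nonneg f)
    finally show ?thesis .
  qed
  then have "max_mod f r \<le> ?B * r ^ p"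
    using r by (intro max_mod_least) auto
  then show ?thesis using r by (simp add: divide_le_eq)
qed


text \<open>If the quotient never exceeded its value at 1, then \<open>f\<close> would be a
  polynomial. Once it does exceed that value at some \<open>R\<close>, the three circles inequality
  forbids any later decrease.\<close>

lemma max_mod_quotient_increasing:
  assumes f: "entire f" "\<not> polynomial_fun f"
  obtains R where "R > 0" "\<And>r s. R \<le> r \<Longrightarrow> r \<le> s \<Longrightarrow> max_mod f r / r ^ p \<le> max_mod f s / s ^ p"
proof -
  define q where "q r = max_mod f r / r ^ p" for r
  have "\<not> eventually (\<lambda>r. max_mod f r \<le> q 1 * r ^ p) at_top"
    using polynomial_fun_if_max_mod_le f by blast
  then obtain R where R: "R \<ge> 1" "max_mod f R > q 1 * R ^ p"
    unfolding eventually_at_top_linorder by (meson linorder_not_le)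
  then have q: "q 1 < q R"
    by (simp add: q_def pos_less_divide_eq)
  have tc: "q b \<le> max (q a) (q c)" if "0 < a" "a \<le> b" "b \<le> c" for a b c
    unfolding q_def using max_mod_three_circles[OF f(1) that] .
  have "q r \<le> q s" if "R \<le> r" "r \<le> s" for r s
    \<comment> \<open>The first instance gives \<open>q s \<ge> q R > q 1\<close>, so the maximum in
      the second one is \<open>q s\<close>.\<close>
    using tc[of 1 R s] tc[of 1 r s] that R(1) q by linarith
  then show thesis
    using R(1) by (intro that[of R]) (auto simp: q_def)
qed

lemma max_mod_at_top:
  assumes f: "entire f" "\<not> polynomial_fun f"
  shows "filterlim (max_mod f) at_top at_top"
  unfolding filterlim_at_top
proof
  fix C
  \<comment> \<open>Exponent 0 is the classical Liouville theorem: a bounded entire function is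
    constant.\<close>
  have "\<not> eventually (\<lambda>r. max_mod f r \<le> C * r ^ 0) at_top"
    using polynomial_fun_if_max_mod_le f by blast
  then obtain R where R: "R \<ge> 1" "max_mod f R > C"
    unfolding eventually_at_top_linorder by (metis linorder_not_le mult.right_neutral power_0)
  have "C \<le> max_mod f r" if "r \<ge> R" for r
    using max_mod_mono[OF f(1), of R r] R that by auto
  then show "eventually (\<lambda>r. C \<le> max_mod f r) at_top"
    by (auto simp: eventually_at_top_linorder)
qed

lemma log_max_mod_at_top:
  "entire f \<Longrightarrow> \<not> polynomial_fun f \<Longrightarrow> filterlim (log_max_mod f) at_top at_top"
  unfolding log_max_mod_def[abs_def] by (intro filterlim_compose[OF ln_at_top] max_mod_at_top)

lemma phi_at_top:
  "entire f \<Longrightarrow> \<not> polynomial_fun f \<Longrightarrow> filterlim (phi f) at_top at_top"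
  unfolding phi_def[abs_def] by (intro filterlim_compose[OF log_max_mod_at_top] exp_at_top)

text \<open>Monotonicity of \<open>max_mod f r / r ^ p\<close> from \<open>r = exp t\<close> to
  \<open>exp (t + 1)\<close> says that the maximum modulus grows by a factor of at least
  \<open>exp p\<close>; here \<open>p\<close> is arbitrary.\<close>

lemma phi_increment_at_top:
  assumes f: "entire f" "\<not> polynomial_fun f"
  shows "filterlim (\<lambda>t. phi f (t + 1) - phi f t) at_top at_top"
  unfolding filterlim_at_top
proof
  fix C :: real
  obtain p :: nat where p: "C \<le> p" using real_arch_simple by blast
  obtain R where R: "R > 0"
    "\<And>r s. R \<le> r \<Longrightarrow> r \<le> s \<Longrightarrow> max_mod f r / r ^ p \<le> max_mod f s / s ^ p"
    using max_mod_quotient_increasing[OF f] by blast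
  have "eventually (\<lambda>t. max_mod f (exp t) \<ge> 1) at_top"
    using filterlim_compose[OF max_mod_at_top[OF f] exp_at_top] by (simp add: filterlim_at_top)
  then show "eventually (\<lambda>t. C \<le> phi f (t + 1) - phi f t) at_top"
    using eventually_ge_at_top[of "ln R"]
  proof eventually_elim
    case (elim t)
    have "R \<le> exp t" using elim R(1) by (metis exp_le_cancel_iff exp_ln)
    then have "max_mod f (exp t) / exp t ^ p \<le> max_mod f (exp (t + 1)) / exp (t + 1) ^ p"
      by (intro R(2)) auto
    also have "exp (t + 1) ^ p = exp (real p) * exp t ^ p"
      by (simp add: exp_add power_mult_distrib exp_of_nat_mult[symmetric])
    finally have "exp (real p) * max_mod f (exp t) \<le> max_mod f (exp (t + 1))"
      by (simp add: field_simps)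
    moreover have "0 < exp (real p) * max_mod f (exp t)"
      using elim by simp
    ultimately have "ln (exp (real p) * max_mod f (exp t)) \<le> ln (max_mod f (exp (t + 1)))"
      by (intro ln_mono) auto
    then have "real p + phi f t \<le> phi f (t + 1)"
      using elim by (simp add: phi_def log_max_mod_def ln_mult)
    then show ?case using p by simp
  qed
qed

section \<open>Functions of comparable growth\<close>

lemma Limsup_ereal_less_PInf_iff:
  "Limsup F (\<lambda>x. ereal (u x)) < \<infinity> \<longleftrightarrow> (\<exists>C. eventually (\<lambda>x. u x \<le> C) F)"
proof
  assume "Limsup F (\<lambda>x. ereal (u x)) < \<infinity>"
  then obtain C :: real where "Limsup F (\<lambda>x. ereal (u x)) < ereal C"
    using less_PInf_Ex_of_nat by auto
  from Limsup_lessD[OF this] show "\<exists>C. eventually (\<lambda>x. u x \<le> C) F"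
    by (intro exI[of _ C]) (auto elim: eventually_mono)
next
  assume "\<exists>C. eventually (\<lambda>x. u x \<le> C) F"
  then obtain C where "eventually (\<lambda>x. ereal (u x) \<le> ereal C) F" by auto
  from Limsup_bounded[OF this] show "Limsup F (\<lambda>x. ereal (u x)) < \<infinity>"
    by (meson ereal_less_PInfty le_less_trans less_ereal.simps(4))
qed

lemma Liminf_ereal_pos_imp:
  assumes "0 < Liminf F (\<lambda>x. ereal (u x))"
  obtains c :: real where "c > 0" "eventually (\<lambda>x. c \<le> u x) F"
proof -
  obtain c where c: "0 < ereal c" "ereal c < Liminf F (\<lambda>x. ereal (u x))"
    using ereal_dense2[OF assms] by blast
  show thesis
    using c(1) less_LiminfD[OF c(2)] by (intro that[of c]) (auto elim: eventually_mono)
qed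

text \<open>For eventually positive \<open>v\<close> this is the relation
  \<open>u = \<Theta>(v)\<close> with \<open>u\<close> eventually positive, stated by products to be
  ready for taking logarithms.\<close>

definition comparable_at_top :: "(real \<Rightarrow> real) \<Rightarrow> (real \<Rightarrow> real) \<Rightarrow> bool" where
  "comparable_at_top u v \<longleftrightarrow>
     (\<exists>c C. 0 < c \<and> eventually (\<lambda>x. c * v x \<le> u x \<and> u x \<le> C * v x) at_top)"

lemma comparable_at_top_lower:
  assumes "comparable_at_top u v"
  obtains c where "0 < c" "eventually (\<lambda>x. c * v x \<le> u x) at_top"
  using assms unfolding comparable_at_top_def eventually_conj_iff by blast

lemma comparable_at_topI:
  assumes "0 < Liminf at_top (\<lambda>x. ereal (u x / v x))" "Limsup at_top (\<lambda>x. ereal (u x / v x)) < \<infinity>"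
    and "filterlim v at_top at_top"
  shows "comparable_at_top u v"
proof -
  obtain c where c: "c > 0" "eventually (\<lambda>x. c \<le> u x / v x) at_top"
    using Liminf_ereal_pos_imp[OF assms(1)] by blast
  obtain C where C: "eventually (\<lambda>x. u x / v x \<le> C) at_top"
    using assms(2) unfolding Limsup_ereal_less_PInf_iff by blast
  have "eventually (\<lambda>x. v x > 0) at_top"
    using assms(3) by (simp add: filterlim_at_top_dense)
  with c(2) C have "eventually (\<lambda>x. c * v x \<le> u x \<and> u x \<le> C * v x) at_top"
    by eventually_elim (auto simp: field_simps)
  with c(1) show ?thesis unfolding comparable_at_top_def by blast
qed

text \<open>Logarithms turn constant factors into bounded differences. This serves at two levels:
  from \<open>max_mod\<close> to \<open>log_max_mod\<close>, and from \<open>log_max_mod\<close> to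
  its logarithm.\<close>

lemma ln_diff_bounded_if_comparable:
  assumes "comparable_at_top u v" "filterlim v at_top at_top"
  obtains K where "eventually (\<lambda>x. \<bar>ln (u x) - ln (v x)\<bar> \<le> K) at_top"
proof -
  obtain c C where c: "0 < c" and C: "eventually (\<lambda>x. c * v x \<le> u x \<and> u x \<le> C * v x) at_top"
    using assms(1) unfolding comparable_at_top_def by blast
  have "eventually (\<lambda>x. v x > 0) at_top"
    using assms(2) by (simp add: filterlim_at_top_dense)
  with C have "eventually (\<lambda>x. \<bar>ln (u x) - ln (v x)\<bar> \<le> \<bar>ln c\<bar> + \<bar>ln C\<bar>) at_top"
  proof eventually_elim
    case (elim x)
    have pos: "0 < c * v x" using elim c by simp
    then have "0 < C * v x" using elim by linarith
    note pos = pos this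
    then have "0 < u x" using elim by linarith
    have "0 < C" using pos(2) elim by (simp add: zero_less_mult_iff)
    then have "ln (c * v x) \<le> ln (u x)" "ln (u x) \<le> ln (C * v x)"
      using elim pos by (auto intro: ln_mono)
    then show ?case
      using c \<open>0 < C\<close> elim by (simp add: ln_mult)
  qed
  then show thesis by (rule that)
qed

section \<open>Invariance of nonpolynomiality, finite order and type II\<close>

text \<open>For polynomial \<open>g\<close>, \<open>log_max_mod g r = O(ln r)\<close>; the lower
  bound passes this to \<open>f\<close>, which would then have polynomial growth.\<close>

lemma not_polynomial_fun_if_log_max_mod_ge:
  assumes f: "entire f" "\<not> polynomial_fun f" and g: "entire g"
    and c: "0 < c" "eventually (\<lambda>r. c * log_max_mod f r \<le> log_max_mod g r) at_top"
  shows "\<not> polynomial_fun g"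
proof
  assume "polynomial_fun g"
  then obtain C N where g_le: "\<And>r. r \<ge> 1 \<Longrightarrow> max_mod g r \<le> C * r ^ N"
    using polynomial_fun_max_mod_le by blast
  define k where "k = nat \<lceil>(\<bar>ln C\<bar> + real N) / c\<rceil>"
  have k: "(\<bar>ln C\<bar> + real N) / c \<le> real k" unfolding k_def by linarith
  have "eventually (\<lambda>r. max_mod f r \<ge> 1) at_top" "eventually (\<lambda>r. log_max_mod f r \<ge> 1) at_top"
    using max_mod_at_top[OF f] log_max_mod_at_top[OF f] by (simp_all add: filterlim_at_top)
  \<comment> \<open>From \<open>r \<ge> exp 1\<close> follows \<open>ln r \<ge> 1\<close>, so the
    constant \<open>ln C\<close> is absorbed into a multiple of \<open>ln r\<close>; this explains
    \<open>k\<close>.\<close>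
  with c(2) eventually_ge_at_top[of "exp 1"]
  have "eventually (\<lambda>r. max_mod f r \<le> 1 * r ^ k) at_top"
  proof eventually_elim
    case (elim r)
    have r: "r \<ge> 1"
      using elim(2) one_le_exp_iff[of "1::real"] by linarith
    moreover have "ln r \<ge> 1"
      using elim(2) r by (simp add: ln_ge_iff)
    ultimately have r: "r \<ge> 1" "r > 0" "ln r \<ge> 1"
      by auto
    \<comment> \<open>Since \<open>ln 0 = 0\<close>, a positive logarithm excludes
      \<open>max_mod g r = 0\<close>.\<close>
    have "0 < c * log_max_mod f r" using c(1) elim by simp
    also have "\<dots> \<le> ln (max_mod g r)" using elim by (simp add: log_max_mod_def)
    finally have "max_mod g r > 0"
      using max_mod_nonneg[OF g r(2)] by (cases "max_mod g r = 0") auto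
    then have "0 < C * r ^ N"
      using g_le[OF r(1)] by linarith
    then have pos: "0 < C" "0 < C * r ^ N"
      using r by (auto simp: zero_less_mult_iff)
    have "c * ln (max_mod f r) \<le> ln (max_mod g r)" using elim by (simp add: log_max_mod_def)
    also have "\<dots> \<le> ln (C * r ^ N)"
      using \<open>max_mod g r > 0\<close> g_le r pos by (intro ln_mono) auto
    also have "\<dots> = ln C + real N * ln r"
      using pos r by (simp add: ln_mult ln_realpow)
    also have "\<dots> \<le> \<bar>ln C\<bar> * ln r + real N * ln r"
      using mult_left_mono[OF r(3), of "\<bar>ln C\<bar>"] by simp
    finally have "ln (max_mod f r) \<le> (\<bar>ln C\<bar> + real N) / c * ln r"
      using c(1) by (simp add: field_simps)
    also have "\<dots> \<le> real k * ln r" using k r by (intro mult_right_mono) auto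
    also have "\<dots> = ln (r ^ k)" using r by (simp add: ln_realpow)
    finally show ?case using elim r by simp
  qed
  then show False using polynomial_fun_if_max_mod_le f by blast
qed

lemma growth_order_finite_iff:
  assumes K: "eventually (\<lambda>r. \<bar>ln (log_max_mod g r) - ln (log_max_mod f r)\<bar> \<le> K) at_top"
  shows "growth_order g < \<infinity> \<longleftrightarrow> growth_order f < \<infinity>"
proof -
  \<comment> \<open>One direction for abstract \<open>u\<close> and \<open>v\<close>, used twice
    with the roles exchanged; \<open>ln r \<ge> 1\<close> keeps the error at most
    \<open>\<bar>K\<bar>\<close> after division.\<close>
  have bdd: "\<exists>C. eventually (\<lambda>r. v r / ln r \<le> C) at_top"
    if "eventually (\<lambda>r. u r / ln r \<le> C) at_top" "eventually (\<lambda>r. \<bar>u r - v r\<bar> \<le> K) at_top"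
    for u v :: "real \<Rightarrow> real" and C K
  proof
    have "eventually (\<lambda>r::real. ln r \<ge> 1) at_top"
      using ln_at_top by (simp add: filterlim_at_top)
    with that show "eventually (\<lambda>r. v r / ln r \<le> C + \<bar>K\<bar>) at_top"
    proof eventually_elim
      case (elim r)
      have "v r \<le> u r + \<bar>K\<bar>" using elim by linarith
      also have "\<dots> \<le> C * ln r + \<bar>K\<bar> * ln r"
        using elim mult_left_mono[OF elim(3), of "\<bar>K\<bar>"]
        by (intro add_mono) (auto simp: divide_le_eq)
      finally show ?case using elim by (simp add: divide_le_eq algebra_simps)
    qed
  qed
  have K': "eventually (\<lambda>r. \<bar>ln (log_max_mod f r) - ln (log_max_mod g r)\<bar> \<le> K) at_top"
    using K by (simp add: abs_minus_commute)
  show ?thesis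
    unfolding growth_order_def Limsup_ereal_less_PInf_iff using bdd[OF _ K] bdd[OF _ K']
    by (intro iffI; elim exE)
qed

text \<open>Apart from the infinite order, type II involves \<open>f\<close> only through the limit
  of \<open>ln (\<psi> t) / ln (phi f t)\<close>. A bounded difference of logarithms that tend to
  infinity has quotient tending to 1, so the same \<open>\<psi>\<close> works.\<close>

lemma type_II_transfer:
  assumes f: "filterlim (phi f) at_top at_top" "type_II f"
    and K: "eventually (\<lambda>r. \<bar>ln (log_max_mod g r) - ln (log_max_mod f r)\<bar> \<le> K) at_top"
  shows "type_II g"
proof -
  have Kphi: "eventually (\<lambda>t. \<bar>ln (phi g t) - ln (phi f t)\<bar> \<le> K) at_top"
    unfolding phi_def using eventually_compose_filterlim[OF K exp_at_top] .
  have lnf: "filterlim (\<lambda>t. ln (phi f t)) at_top at_top"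
    by (rule filterlim_compose[OF ln_at_top f(1)])
  have "filterlim (\<lambda>t. ln (phi f t) + (- K)) at_top at_top"
    using filterlim_tendsto_add_at_top[OF tendsto_const lnf, of "-K"] by (simp add: add.commute)
  then have lng: "filterlim (\<lambda>t. ln (phi g t)) at_top at_top"
    by (rule filterlim_at_top_mono) (use Kphi in eventually_elim, linarith)
  have "((\<lambda>t. (ln (phi f t) - ln (phi g t)) / ln (phi g t)) \<longlongrightarrow> 0) at_top"
  proof (rule Lim_null_comparison)
    show "((\<lambda>t. K / ln (phi g t)) \<longlongrightarrow> 0) at_top"
      by (intro tendsto_divide_0[OF tendsto_const] filterlim_at_top_imp_at_infinity lng)
    have "eventually (\<lambda>t. ln (phi g t) > 0) at_top"
      using lng by (simp add: filterlim_at_top_dense)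
    with Kphi show "eventually (\<lambda>t. norm ((ln (phi f t) - ln (phi g t)) / ln (phi g t)) \<le> K / ln (phi g t)) at_top"
      by eventually_elim (simp add: divide_right_mono abs_minus_commute)
  qed
  from tendsto_add[OF tendsto_const this, of 1]
  have "((\<lambda>t. 1 + (ln (phi f t) - ln (phi g t)) / ln (phi g t)) \<longlongrightarrow> 1) at_top"
    by simp
  moreover have "eventually (\<lambda>t. 1 + (ln (phi f t) - ln (phi g t)) / ln (phi g t) = ln (phi f t) / ln (phi g t)) at_top"
    using filterlim_at_top_dense[THEN iffD1, OF lng, rule_format, of 0]
    by eventually_elim (simp add: field_simps)
  ultimately have quot: "((\<lambda>t. ln (phi f t) / ln (phi g t)) \<longlongrightarrow> 1) at_top"
    by (rule Lim_transform_eventually)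
  have trans: "((\<lambda>t. ln (\<psi> t) / ln (phi g t)) \<longlongrightarrow> 1) at_top"
    if "((\<lambda>t. ln (\<psi> t) / ln (phi f t)) \<longlongrightarrow> 1) at_top" for \<psi>
  proof -
    have "((\<lambda>t. ln (\<psi> t) / ln (phi f t) * (ln (phi f t) / ln (phi g t))) \<longlongrightarrow> 1) at_top"
      using tendsto_mult[OF that quot] by simp
    moreover have "eventually (\<lambda>t. ln (\<psi> t) / ln (phi f t) * (ln (phi f t) / ln (phi g t))
        = ln (\<psi> t) / ln (phi g t)) at_top"
      using filterlim_at_top_dense[THEN iffD1, OF lnf, rule_format, of 0]
      by eventually_elim simp
    ultimately show ?thesis by (rule Lim_transform_eventually)
  qed
  have "growth_order g = \<infinity>"
    using f(2) growth_order_finite_iff[OF K] unfolding type_II_def by simp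
  then show ?thesis
    using f(2) trans unfolding type_II_def by blast
qed

text \<open>Infinite order excludes type I, so \<open>f\<close> has type II, which is
  transferred.\<close>

lemma class_C_if_log_max_mod_comparable:
  assumes f: "class_C f" "growth_order f = \<infinity>" and g: "entire g"
    and c: "comparable_at_top (log_max_mod g) (log_max_mod f)"
  shows "class_C g"
proof -
  have f': "entire f" "\<not> polynomial_fun f" "type_II f"
    using f by (auto simp: class_C_def type_I_def)
  obtain K where "eventually (\<lambda>r. \<bar>ln (log_max_mod g r) - ln (log_max_mod f r)\<bar> \<le> K) at_top"
    using ln_diff_bounded_if_comparable[OF c log_max_mod_at_top[OF f'(1,2)]] by blast
  then have "type_II g"
    by (rule type_II_transfer[OF phi_at_top[OF f'(1,2)] f'(3)])
  moreover obtain c where "0 < c" "eventually (\<lambda>r. c * log_max_mod f r \<le> log_max_mod g r) at_top"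
    using comparable_at_top_lower[OF c] by blast
  ultimately show ?thesis
    unfolding class_C_def using not_polynomial_fun_if_log_max_mod_ge f' g by blast
qed

section \<open>Bounded perturbations and type I\<close>

lemma comparable_at_top_if_diff_bounded:
  assumes K: "eventually (\<lambda>x. \<bar>u x - v x\<bar> \<le> K) at_top" and v: "filterlim v at_top at_top"
  shows "comparable_at_top u v"
proof -
  \<comment> \<open>Then the error \<open>K\<close> is at most half of \<open>v x\<close>.\<close>
  have "eventually (\<lambda>x. v x \<ge> 2 * \<bar>K\<bar>) at_top"
    using v by (simp add: filterlim_at_top)
  with K have "eventually (\<lambda>x. 1 / 2 * v x \<le> u x \<and> u x \<le> 2 * v x) at_top"
    by eventually_elim linarith
  then show ?thesis
    unfolding comparable_at_top_def by (intro exI[of _ "1/2"] exI[of _ 2]) simp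
qed

text \<open>Increments of \<open>phi\<close> change by at most \<open>2 * K\<close>, which is
  negligible because the increments for \<open>f\<close> tend to infinity.\<close>

lemma type_I_if_log_max_mod_diff_bounded:
  assumes f: "entire f" "\<not> polynomial_fun f" "type_I f"
    and K: "eventually (\<lambda>r. \<bar>log_max_mod g r - log_max_mod f r\<bar> \<le> K) at_top"
  shows "type_I g"
proof -
  obtain K' where "eventually (\<lambda>r. \<bar>ln (log_max_mod g r) - ln (log_max_mod f r)\<bar> \<le> K') at_top"
    using ln_diff_bounded_if_comparable comparable_at_top_if_diff_bounded[OF K] log_max_mod_at_top[OF f(1,2)] by metis
  then have "growth_order g < \<infinity>"
    using growth_order_finite_iff f(3) unfolding type_I_def by blast
  have inc: "eventually (\<lambda>t. \<bar>(phi g (t + 1) - phi g t) - (phi f (t + 1) - phi f t)\<bar> \<le> 2 * K) at_top"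
  proof -
    have K0: "eventually (\<lambda>t. \<bar>phi g t - phi f t\<bar> \<le> K) at_top"
      unfolding phi_def using eventually_compose_filterlim[OF K exp_at_top] .
    have "filterlim (\<lambda>t::real. t + 1) at_top at_top"
      by real_asymp
    from eventually_compose_filterlim[OF K0 this] K0 show ?thesis
      by eventually_elim linarith
  qed
  have shift: "filterlim (\<lambda>t::real. t - 1) at_top at_top"
    by real_asymp
  obtain C where "eventually (\<lambda>t. (phi f (t + 1) - phi f t) / (phi f t - phi f (t - 1)) \<le> C) at_top"
    using f(3) unfolding type_I_def Limsup_ereal_less_PInf_iff by blast
  \<comment> \<open>The threshold ensures, for the increments \<open>x\<close> of
    \<open>phi f\<close> and \<open>y\<close> of \<open>phi g\<close> below, that
    \<open>x \<le> 2 * y\<close> and \<open>2 * K \<le> y\<close>; hence the final bound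
    \<open>2 * \<bar>C\<bar> + 1\<close>.\<close>
  moreover have "eventually (\<lambda>t. phi f t - phi f (t - 1) \<ge> 4 * \<bar>K\<bar> + 1) at_top"
    using filterlim_compose[OF phi_increment_at_top[OF f(1,2)] shift] by (simp add: filterlim_at_top)
  moreover have "eventually (\<lambda>t. \<bar>(phi g t - phi g (t - 1)) - (phi f t - phi f (t - 1))\<bar> \<le> 2 * K) at_top"
    using eventually_compose_filterlim[OF inc shift] by simp
  ultimately have "eventually (\<lambda>t. (phi g (t + 1) - phi g t) / (phi g t - phi g (t - 1)) \<le> 2 * \<bar>C\<bar> + 1) at_top"
    using inc
  proof eventually_elim
    case (elim t)
    define x y where "x = phi f t - phi f (t - 1)" and "y = phi g t - phi g (t - 1)"
    have x: "x \<ge> 4 * \<bar>K\<bar> + 1" and y: "y \<ge> x - 2 * K"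
      using elim unfolding x_def y_def by linarith+
    have "phi f (t + 1) - phi f t \<le> C * x"
      using elim x by (simp add: x_def[symmetric] divide_le_eq)
    also have "\<dots> \<le> \<bar>C\<bar> * (2 * y)"
      using x y by (intro mult_mono) auto
    finally have "phi g (t + 1) - phi g t \<le> \<bar>C\<bar> * (2 * y) + y"
      using elim x y by linarith
    moreover have "y > 0" using x y by linarith
    ultimately show ?case
      unfolding y_def[symmetric] by (simp add: divide_le_eq algebra_simps)
  qed
  then show ?thesis
    using \<open>growth_order g < \<infinity>\<close> unfolding type_I_def Limsup_ereal_less_PInf_iff by blast
qed

section \<open>Stability of the class under comparison and powers\<close>

text \<open>Type I uses the bounded difference of \<open>log_max_mod\<close>; type II needs only the
  weaker comparability that this difference implies.\<close>

lemma class_C_if_max_mod_comparable: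
  assumes f: "class_C f" and g: "entire g"
    and c: "comparable_at_top (max_mod g) (max_mod f)"
  shows "class_C g"
proof -
  have f': "entire f" "\<not> polynomial_fun f" "type_I f \<or> type_II f"
    using f by (auto simp: class_C_def)
  obtain K where K: "eventually (\<lambda>r. \<bar>log_max_mod g r - log_max_mod f r\<bar> \<le> K) at_top"
    unfolding log_max_mod_def using ln_diff_bounded_if_comparable[OF c max_mod_at_top[OF f'(1,2)]] by blast
  have comp: "comparable_at_top (log_max_mod g) (log_max_mod f)"
    by (rule comparable_at_top_if_diff_bounded[OF K log_max_mod_at_top[OF f'(1,2)]])
  show ?thesis
  proof (cases "type_I f")
    case True
    obtain c where "0 < c" "eventually (\<lambda>r. c * log_max_mod f r \<le> log_max_mod g r) at_top"
      using comparable_at_top_lower[OF comp] by blast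
    then have "\<not> polynomial_fun g"
      using not_polynomial_fun_if_log_max_mod_ge f' g by blast
    then show ?thesis
      using type_I_if_log_max_mod_diff_bounded[OF f'(1,2) True K] g by (simp add: class_C_def)
  next
    case False
    then show ?thesis
      using class_C_if_log_max_mod_comparable[OF f _ g comp] f'(3) by (simp add: type_II_def)
  qed
qed

lemma class_C_power:
  assumes f: "class_C f" and k: "k \<ge> 1"
  shows "class_C (\<lambda>z. f z ^ k)"
proof -
  have f': "entire f" "\<not> polynomial_fun f" "type_I f \<or> type_II f"
    using f by (auto simp: class_C_def)
  \<comment> \<open>The identity also covers \<open>max_mod f r = 0\<close>, as
    \<open>ln 0 = 0\<close>.\<close>
  have log: "log_max_mod (\<lambda>z. f z ^ k) r = real k * log_max_mod f r" if "r > 0" for r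
    using max_mod_power[OF f'(1) that k] k max_mod_nonneg[OF f'(1) that]
    by (cases "max_mod f r = 0") (auto simp: log_max_mod_def ln_realpow)
  have ev: "eventually (\<lambda>r. log_max_mod (\<lambda>z. f z ^ k) r = real k * log_max_mod f r) at_top"
    using eventually_gt_at_top[of 0] by eventually_elim (rule log)
  then have comp: "comparable_at_top (log_max_mod (\<lambda>z. f z ^ k)) (log_max_mod f)"
    unfolding comparable_at_top_def using k
    by (intro exI[of _ "real k"]) (auto elim: eventually_mono)
  show ?thesis
  proof (cases "type_I f")
    case True
    have phi: "phi (\<lambda>z. f z ^ k) t = real k * phi f t" for t
      by (simp add: phi_def log)
    have "type_I (\<lambda>z. f z ^ k)"
    proof -
      obtain K where "eventually (\<lambda>r. \<bar>ln (log_max_mod (\<lambda>z. f z ^ k) r) - ln (log_max_mod f r)\<bar> \<le> K) at_top"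
        using ln_diff_bounded_if_comparable[OF comp log_max_mod_at_top[OF f'(1,2)]] by blast
      \<comment> \<open>The factor \<open>real k\<close> cancels from the quotient of increments,
        leaving that of \<open>f\<close>.\<close>
      from growth_order_finite_iff[OF this] show ?thesis
        using True k unfolding type_I_def phi right_diff_distrib[symmetric] by simp
    qed
    moreover have "\<not> polynomial_fun (\<lambda>z. f z ^ k)"
      using k ev by (intro not_polynomial_fun_if_log_max_mod_ge[OF f'(1,2) entire_power[OF f'(1)], of "real k"])
        (auto elim: eventually_mono)
    ultimately show ?thesis
      using entire_power[OF f'(1)] by (simp add: class_C_def)
  next
    case False
    then show ?thesis
      using class_C_if_log_max_mod_comparable[OF f _ entire_power[OF f'(1)] comp] f'(3)
      by (simp add: type_II_def)
  qed
qed

theorem proposition1p11: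
  fixes f :: "complex ^ 'n \<Rightarrow> complex" and g :: "complex ^ 'm \<Rightarrow> complex"
  shows
    "(class_C f \<and> entire g \<and>
        0 < Liminf at_top (\<lambda>r. ereal (max_mod g r / max_mod f r)) \<and>
        Liminf at_top (\<lambda>r. ereal (max_mod g r / max_mod f r))
          \<le> Limsup at_top (\<lambda>r. ereal (max_mod g r / max_mod f r)) \<and>
        Limsup at_top (\<lambda>r. ereal (max_mod g r / max_mod f r)) < \<infinity>
      \<longrightarrow> class_C g) \<and>
     (class_C f \<and> growth_order f = \<infinity> \<and> entire g \<and>
        0 < Liminf at_top (\<lambda>r. ereal (log_max_mod g r / log_max_mod f r)) \<and>
        Liminf at_top (\<lambda>r. ereal (log_max_mod g r / log_max_mod f r))
          \<le> Limsup at_top (\<lambda>r. ereal (log_max_mod g r / log_max_mod f r)) \<and>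
        Limsup at_top (\<lambda>r. ereal (log_max_mod g r / log_max_mod f r)) < \<infinity>
      \<longrightarrow> class_C g) \<and>
     (class_C f \<longrightarrow> (\<forall>k::nat. k \<ge> 1 \<longrightarrow> class_C (\<lambda>z. f z ^ k)))"
proof (intro conjI impI allI)
  assume h: "class_C f \<and> entire g \<and>
        0 < Liminf at_top (\<lambda>r. ereal (max_mod g r / max_mod f r)) \<and>
        Liminf at_top (\<lambda>r. ereal (max_mod g r / max_mod f r))
          \<le> Limsup at_top (\<lambda>r. ereal (max_mod g r / max_mod f r)) \<and>
        Limsup at_top (\<lambda>r. ereal (max_mod g r / max_mod f r)) < \<infinity>"
  then have "comparable_at_top (max_mod g) (max_mod f)"
    by (intro comparable_at_topI max_mod_at_top) (auto simp: class_C_def)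
  then show "class_C g"
    using h class_C_if_max_mod_comparable by blast
next
  assume h: "class_C f \<and> growth_order f = \<infinity> \<and> entire g \<and>
        0 < Liminf at_top (\<lambda>r. ereal (log_max_mod g r / log_max_mod f r)) \<and>
        Liminf at_top (\<lambda>r. ereal (log_max_mod g r / log_max_mod f r))
          \<le> Limsup at_top (\<lambda>r. ereal (log_max_mod g r / log_max_mod f r)) \<and>
        Limsup at_top (\<lambda>r. ereal (log_max_mod g r / log_max_mod f r)) < \<infinity>"
  then have "comparable_at_top (log_max_mod g) (log_max_mod f)"
    by (intro comparable_at_topI log_max_mod_at_top) (auto simp: class_C_def)
  then show "class_C g"
    using h class_C_if_log_max_mod_comparable by blast
next
  fix k :: nat
  assume "class_C f" "k \<ge> 1"
  then show "class_C (\<lambda>z. f z ^ k)" by (rule class_C_power)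
qed

end
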